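(* Let $\Bbbk$ be an algebraically closed field of characteristic $2$. There does not exist a Springer isomorphism for $PGL_2$ over $\Bbbk$.
   Context: A Springer isomorphism for an algebraic group $G$ with Lie algebra $\mathfrak{g}$ is a $G$-equivariant isomorphism of varieties $\mathcal{N}(\mathfrak{g})\to\mathcal{U}(G)$ from the nilpotent variety of $\mathfrak{g}$ (with adjoint action) to the unipotent variety of $G$ (with conjugation action). *)

theory Defs
  imports
    "HOL-Analysis.Determinants"
    "HOL-Algebra.Coset"
    "HOL-Computational_Algebra.Polynomial"
begin

(* Classical affine varieties over an algebraically closed field: a set of points together
   with its algebra of regular functions. All functions are extensional, i.e. they take the
   value undefined off the set of points, so that equality in these sets is equality of
   functions on the points. *)

record ('x, 'k) variety =
  points :: "'x set"
  regular :: "('x \<Rightarrow> 'k) set"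

inductive_set function_algebra :: "'x set \<Rightarrow> ('x \<Rightarrow> 'k::comm_ring_1) set \<Rightarrow> ('x \<Rightarrow> 'k) set"
  for X S where
  const: "(\<lambda>x\<in>X. c) \<in> function_algebra X S"
| gen: "f \<in> S \<Longrightarrow> restrict f X \<in> function_algebra X S"
| add: "\<lbrakk>f \<in> function_algebra X S; g \<in> function_algebra X S\<rbrakk>
    \<Longrightarrow> (\<lambda>x\<in>X. f x + g x) \<in> function_algebra X S"
| mult: "\<lbrakk>f \<in> function_algebra X S; g \<in> function_algebra X S\<rbrakk>
    \<Longrightarrow> (\<lambda>x\<in>X. f x * g x) \<in> function_algebra X S"

definition variety_morphism ::
  "('x, 'k) variety \<Rightarrow> ('y, 'k) variety \<Rightarrow> ('x \<Rightarrow> 'y) \<Rightarrow> bool" where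
  "variety_morphism X Y \<phi> \<longleftrightarrow>
     \<phi> ` points X \<subseteq> points Y \<and>
     (\<forall>f\<in>regular Y. (\<lambda>x\<in>points X. f (\<phi> x)) \<in> regular X)"

definition variety_isomorphism ::
  "('x, 'k) variety \<Rightarrow> ('y, 'k) variety \<Rightarrow> ('x \<Rightarrow> 'y) \<Rightarrow> bool" where
  "variety_isomorphism X Y \<phi> \<longleftrightarrow>
     bij_betw \<phi> (points X) (points Y) \<and>
     variety_morphism X Y \<phi> \<and>
     variety_morphism Y X (inv_into (points X) \<phi>)"

(* Only used for closed Z: the regular functions on a closed subvariety of an affine variety
   are the restrictions of the regular functions on the ambient variety. *)
definition subvariety :: "('x, 'k) variety \<Rightarrow> 'x set \<Rightarrow> ('x, 'k) variety" where
  "subvariety X Z = \<lparr>points = Z, regular = (\<lambda>f. restrict f Z) ` regular X\<rparr>"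


(* The raw data of an affine algebraic group; the axioms are not part of the record, and the
   definitions below have their usual meaning for data that satisfy them. *)
record ('g, 'k) algebraic_group = "'g monoid" +
  coord :: "('g \<Rightarrow> 'k) set"

definition group_variety :: "('g, 'k, 'm) algebraic_group_scheme \<Rightarrow> ('g, 'k) variety" where
  "group_variety G = \<lparr>points = carrier G, regular = coord G\<rparr>"

definition conjugation :: "('g, 'm) monoid_scheme \<Rightarrow> 'g \<Rightarrow> 'g \<Rightarrow> 'g" where
  "conjugation G g x = g \<otimes>\<^bsub>G\<^esub> x \<otimes>\<^bsub>G\<^esub> inv\<^bsub>G\<^esub> g"

definition pullback :: "('g, 'm) monoid_scheme \<Rightarrow> ('g \<Rightarrow> 'g) \<Rightarrow> ('g \<Rightarrow> 'k) \<Rightarrow> 'g \<Rightarrow> 'k" where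
  "pullback G \<alpha> f = (\<lambda>x\<in>carrier G. f (\<alpha> x))"

(* The left-invariant derivations of the coordinate ring. *)
definition lie_algebra ::
  "('g, 'k::field, 'm) algebraic_group_scheme \<Rightarrow> (('g \<Rightarrow> 'k) \<Rightarrow> ('g \<Rightarrow> 'k)) set" where
  "lie_algebra G = {D \<in> coord G \<rightarrow>\<^sub>E coord G.
     (\<forall>f\<in>coord G. \<forall>h\<in>coord G.
        D (\<lambda>x\<in>carrier G. f x + h x) = (\<lambda>x\<in>carrier G. D f x + D h x)) \<and>
     (\<forall>c. \<forall>f\<in>coord G.
        D (\<lambda>x\<in>carrier G. c * f x) = (\<lambda>x\<in>carrier G. c * D f x)) \<and>
     (\<forall>f\<in>coord G. \<forall>h\<in>coord G.
        D (\<lambda>x\<in>carrier G. f x * h x) = (\<lambda>x\<in>carrier G. D f x * h x + f x * D h x)) \<and>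
     (\<forall>g\<in>carrier G. \<forall>f\<in>coord G.
        D (pullback G (\<lambda>x. g \<otimes>\<^bsub>G\<^esub> x) f) = pullback G (\<lambda>x. g \<otimes>\<^bsub>G\<^esub> x) (D f))}"

(* The differential of the automorphism Int g of G, acting on left-invariant vector fields
   by push-forward. *)
definition adjoint_action ::
  "('g, 'k, 'm) algebraic_group_scheme \<Rightarrow> 'g
     \<Rightarrow> (('g \<Rightarrow> 'k) \<Rightarrow> ('g \<Rightarrow> 'k)) \<Rightarrow> (('g \<Rightarrow> 'k) \<Rightarrow> ('g \<Rightarrow> 'k))" where
  "adjoint_action G g D =
     (\<lambda>f\<in>coord G. pullback G (conjugation G (inv\<^bsub>G\<^esub> g)) (D (pullback G (conjugation G g) f)))"

definition lie_functionals ::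
  "('g, 'k::field, 'm) algebraic_group_scheme \<Rightarrow> ((('g \<Rightarrow> 'k) \<Rightarrow> ('g \<Rightarrow> 'k)) \<Rightarrow> 'k) set" where
  "lie_functionals G = {l.
     (\<forall>D\<in>lie_algebra G. \<forall>E\<in>lie_algebra G.
        l (\<lambda>f\<in>coord G. \<lambda>x\<in>carrier G. D f x + E f x) = l D + l E) \<and>
     (\<forall>c. \<forall>D\<in>lie_algebra G.
        l (\<lambda>f\<in>coord G. \<lambda>x\<in>carrier G. c * D f x) = c * l D)}"

(* The (finite-dimensional) Lie algebra as an affine space. *)
definition lie_variety ::
  "('g, 'k::field, 'm) algebraic_group_scheme \<Rightarrow> (('g \<Rightarrow> 'k) \<Rightarrow> ('g \<Rightarrow> 'k), 'k) variety" where
  "lie_variety G = \<lparr>points = lie_algebra G,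
     regular = function_algebra (lie_algebra G) (lie_functionals G)\<rparr>"

definition locally_nilpotent ::
  "('g, 'k::field, 'm) algebraic_group_scheme \<Rightarrow> (('g \<Rightarrow> 'k) \<Rightarrow> ('g \<Rightarrow> 'k)) \<Rightarrow> bool" where
  "locally_nilpotent G T \<longleftrightarrow> (\<forall>f\<in>coord G. \<exists>n. (T ^^ n) f = (\<lambda>x\<in>carrier G. 0))"

(* Nilpotent and unipotent elements in the sense of the Jordan decomposition: a left-invariant
   derivation D acts on the coordinate ring as it stands, a group element g acts by the right
   translation f(x) \<mapsto> f(xg). *)
definition nilpotent_elements ::
  "('g, 'k::field, 'm) algebraic_group_scheme \<Rightarrow> (('g \<Rightarrow> 'k) \<Rightarrow> ('g \<Rightarrow> 'k)) set" where
  "nilpotent_elements G = {D \<in> lie_algebra G. locally_nilpotent G D}"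

definition unipotent_elements :: "('g, 'k::field, 'm) algebraic_group_scheme \<Rightarrow> 'g set" where
  "unipotent_elements G =
     {g \<in> carrier G. locally_nilpotent G (\<lambda>f. \<lambda>x\<in>carrier G. f (x \<otimes>\<^bsub>G\<^esub> g) - f x)}"

definition nilpotent_variety ::
  "('g, 'k::field, 'm) algebraic_group_scheme \<Rightarrow> (('g \<Rightarrow> 'k) \<Rightarrow> ('g \<Rightarrow> 'k), 'k) variety" where
  "nilpotent_variety G = subvariety (lie_variety G) (nilpotent_elements G)"

definition unipotent_variety ::
  "('g, 'k::field, 'm) algebraic_group_scheme \<Rightarrow> ('g, 'k) variety" where
  "unipotent_variety G = subvariety (group_variety G) (unipotent_elements G)"

definition springer_isomorphism ::
  "('g, 'k::field, 'm) algebraic_group_scheme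
     \<Rightarrow> ((('g \<Rightarrow> 'k) \<Rightarrow> ('g \<Rightarrow> 'k)) \<Rightarrow> 'g) \<Rightarrow> bool" where
  "springer_isomorphism G \<phi> \<longleftrightarrow>
     variety_isomorphism (nilpotent_variety G) (unipotent_variety G) \<phi> \<and>
     (\<forall>g\<in>carrier G. \<forall>D\<in>nilpotent_elements G.
        \<phi> (adjoint_action G g D) = conjugation G g (\<phi> D))"


definition GL :: "('k::field ^ 'n ^ 'n, 'k) algebraic_group" where
  "GL = \<lparr>carrier = {A. invertible A}, mult = (**), one = mat 1,
     coord = function_algebra {A. invertible A}
       (insert (\<lambda>A. inverse (det A)) {(\<lambda>A. A $ i $ j) | i j. True})\<rparr>"

definition scalars :: "('k::field ^ 'n ^ 'n) set" where
  "scalars = {mat c | c. c \<noteq> 0}"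

(* Quotient by a closed normal subgroup H: the regular functions on G/H are the functions
   whose pull-back along the projection from G to G/H is regular. *)
definition quotient_group ::
  "('g, 'k, 'm) algebraic_group_scheme \<Rightarrow> 'g set \<Rightarrow> ('g set, 'k) algebraic_group" where
  "quotient_group G H = \<lparr>carrier = carrier (G Mod H), mult = mult (G Mod H), one = one (G Mod H),
     coord = {f \<in> extensional (carrier (G Mod H)).
       (\<lambda>x\<in>carrier G. f (H #>\<^bsub>G\<^esub> x)) \<in> coord G}\<rparr>"

definition PGL :: "(('k::field ^ 'n ^ 'n) set, 'k) algebraic_group" where
  "PGL = quotient_group GL scalars"

lemma group_GL: "group (GL :: ('k::field ^ 'n ^ 'n, 'k) algebraic_group)"
proof (rule groupI)
  fix A :: "'k ^ 'n ^ 'n"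
  assume "A \<in> carrier GL"
  then show "\<exists>B\<in>carrier GL. B \<otimes>\<^bsub>GL\<^esub> A = \<one>\<^bsub>GL\<^esub>"
    by (auto simp: GL_def invertible_def)
next
  show "\<one>\<^bsub>GL\<^esub> \<in> carrier (GL :: ('k ^ 'n ^ 'n, 'k) algebraic_group)"
    by (auto simp: GL_def invertible_def)
qed (auto simp: GL_def invertible_mult matrix_mul_assoc)

lemma scalars_commute: "Z \<in> scalars \<Longrightarrow> A ** Z = Z ** A"
proof -
  assume "Z \<in> scalars"
  then obtain c where Z: "Z = mat c" by (auto simp: scalars_def)
  have "(\<Sum>k\<in>UNIV. A $ i $ k * (if k = j then c else 0)) = A $ i $ j * c" for i j
    by (simp add: if_distrib [where f = "\<lambda>x. _ * x"] cong: if_cong)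
  moreover have "(\<Sum>k\<in>UNIV. (if i = k then c else 0) * A $ k $ j) = c * A $ i $ j" for i j
    by (simp add: if_distrib [where f = "\<lambda>x. x * _"] cong: if_cong)
  ultimately show ?thesis
    by (simp add: Z matrix_matrix_mult_def mat_def vec_eq_iff mult.commute)
qed

lemma scalars_mult:
  "mat c ** mat d = (mat (c * d) :: 'k::field ^ 'n ^ 'n)"
proof -
  have "(\<Sum>k\<in>UNIV. (if i = k then c else 0) * (if k = j then d else 0)) =
    (if i = j then c * d else 0)" for i j :: 'n
    by (simp add: if_distrib [where f = "\<lambda>x. x * _"] cong: if_cong)
  then show ?thesis
    by (simp add: matrix_matrix_mult_def mat_def vec_eq_iff)
qed

lemma normal_scalars: "scalars \<lhd> (GL :: ('k::field ^ 'n ^ 'n, 'k) algebraic_group)"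
proof -
  interpret group "GL :: ('k ^ 'n ^ 'n, 'k) algebraic_group" by (rule group_GL)
  have inverse_scalar: "mat c ** mat (inverse c) = (mat 1 :: 'k ^ 'n ^ 'n)"
    "mat (inverse c) ** mat c = (mat 1 :: 'k ^ 'n ^ 'n)" if "c \<noteq> 0" for c
    using that by (simp_all add: scalars_mult)
  then have inv_scalar: "(mat c :: 'k ^ 'n ^ 'n) \<in> carrier GL" if "c \<noteq> 0" for c
    using that unfolding GL_def invertible_def by auto
  have "inv\<^bsub>GL\<^esub> (mat c) = (mat (inverse c) :: 'k ^ 'n ^ 'n)" if "c \<noteq> 0" for c
    by (rule inv_equality) (use that inverse_scalar inv_scalar in \<open>auto simp: GL_def\<close>)
  then have "subgroup scalars (GL :: ('k ^ 'n ^ 'n, 'k) algebraic_group)"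
    using inv_scalar
    by (intro subgroupI) (auto simp: scalars_def GL_def scalars_mult intro: exI[of _ 1])
  then show ?thesis
    unfolding normal_def normal_axioms_def r_coset_def l_coset_def
    using group_GL
    by (auto simp: GL_def) (metis scalars_commute)+
qed

lemma group_PGL: "group (PGL :: (('k::field ^ 'n ^ 'n) set, 'k) algebraic_group)"
proof -
  have "group ((GL :: ('k ^ 'n ^ 'n, 'k) algebraic_group) Mod scalars)"
    by (rule normal.factorgroup_is_group[OF normal_scalars])
  then show ?thesis
    unfolding PGL_def quotient_group_def group_def group_axioms_def monoid_def Units_def
    by simp
qed

end

theory Submission
  imports Defs
begin

text \<open>
  In characteristic \<open>2\<close> the involution \<open>w\<close> with matrix \<open>(0, 1; 1, 0)\<close> is a unipotent element of
  \<open>PGL\<^sub>2\<close> (\<open>antidiagonal_unipotent\<close>). Suppose that \<open>\<phi>\<close> is a Springer isomorphism and let \<open>D\<close> be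
  the nilpotent derivation with \<open>\<phi> D = w\<close>. The contradiction comes from the torus of the elements
  \<open>h t = diag(t, 1)\<close>.

  The Lie algebra has the torus weights \<open>t\<close>, \<open>1\<close> and \<open>1 / t\<close>. A coordinate of \<open>D\<close> of weight \<open>t\<close> or
  \<open>1 / t\<close> is a linear functional, so it is carried by the inverse of \<open>\<phi>\<close> to a regular function \<open>f\<close>
  on the unipotent variety, which extends to \<open>PGL\<^sub>2\<close>. By equivariance \<open>f\<close> takes the value \<open>t * c\<close> or
  \<open>c / t\<close> at the conjugate of \<open>w\<close> by \<open>h t\<close>, where \<open>c\<close> is the coordinate of \<open>D\<close>. Modulo
  scalars, however, this conjugate is \<open>(0, t\<^sup>2; 1, 0)\<close> (\<open>conjugation_antidiagonal\<close>), so that \<open>f\<close>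
  restricts to a Laurent polynomial in \<open>t\<^sup>2\<close> (\<open>antidiagonal_laurent\<close>). Hence \<open>c = 0\<close>
  (\<open>odd_laurent_constant_zero\<close>): both coordinates of nontrivial weight vanish on \<open>D\<close>, and \<open>D\<close> is
  fixed by the torus (\<open>adjoint_action_dilation_fixed\<close>). Then \<open>w\<close> is fixed by the torus as well,
  which is absurd.

  What has to be known of the Lie algebra for this is an upper bound only: a left-invariant
  derivation is determined by its values at the unit on the four functions \<open>a\<^sub>i\<^sub>j a\<^sub>1\<^sub>1 / det\<close>, which
  are weight vectors (\<open>lie_algebra_PGL_eqI\<close>). Geometrically, the unipotent variety is the projective
  plane without a conic and the nilpotent variety is the affine plane; the odd-weight functions on
  the former all vanish on the line that contains \<open>w\<close>, and those on the latter do not.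
\<close>

section \<open>Left-invariant derivations and the adjoint action\<close>

text \<open>
  What an affine algebraic group contributes to the formal part of the argument: its coordinate
  ring is a ring of functions that is stable under left and right translations.
\<close>
locale translation_closed = group G
  for G :: "('g, 'k::field) algebraic_group" (structure) +
  assumes coord_extensional: "f \<in> coord G \<Longrightarrow> f \<in> extensional (carrier G)"
    and coord_const: "(\<lambda>x\<in>carrier G. c) \<in> coord G"
    and coord_add: "\<lbrakk>f \<in> coord G; h \<in> coord G\<rbrakk> \<Longrightarrow> (\<lambda>x\<in>carrier G. f x + h x) \<in> coord G"
    and coord_mult: "\<lbrakk>f \<in> coord G; h \<in> coord G\<rbrakk> \<Longrightarrow> (\<lambda>x\<in>carrier G. f x * h x) \<in> coord G"
    and coord_translate: "\<lbrakk>f \<in> coord G; a \<in> carrier G; b \<in> carrier G\<rbrakk>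
      \<Longrightarrow> pullback G (\<lambda>x. a \<otimes> x \<otimes> b) f \<in> coord G"
begin

lemma coord_scale: "f \<in> coord G \<Longrightarrow> (\<lambda>x\<in>carrier G. c * f x) \<in> coord G"
  using coord_mult[OF coord_const, of f c] by (simp cong: restrict_cong)

lemma coord_left_translate:
  assumes "f \<in> coord G" "a \<in> carrier G"
  shows "pullback G (\<lambda>x. a \<otimes> x) f \<in> coord G"
proof -
  have "pullback G (\<lambda>x. a \<otimes> x) f = pullback G (\<lambda>x. a \<otimes> x \<otimes> \<one>) f"
    using assms by (auto simp: pullback_def fun_eq_iff)
  then show ?thesis using coord_translate[OF assms one_closed] by simp
qed

lemma coord_conjugation:
  assumes "f \<in> coord G" "g \<in> carrier G"
  shows "pullback G (conjugation G g) f \<in> coord G"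
  using coord_translate[OF assms inv_closed[OF assms(2)]] by (simp add: conjugation_def [abs_def])

lemma conjugation_closed [simp]:
  "g \<in> carrier G \<Longrightarrow> x \<in> carrier G \<Longrightarrow> conjugation G g x \<in> carrier G"
  by (simp add: conjugation_def)

lemma conjugation_mult:
  "g \<in> carrier G \<Longrightarrow> x \<in> carrier G \<Longrightarrow> y \<in> carrier G \<Longrightarrow>
    conjugation G g (x \<otimes> y) = conjugation G g x \<otimes> conjugation G g y"
  by (simp add: conjugation_def m_assoc) (metis inv_closed l_inv l_one m_assoc m_closed)

lemma conjugation_cancel [simp]:
  assumes "g \<in> carrier G" "x \<in> carrier G"
  shows "conjugation G g (conjugation G (inv g) x) = x"
    and "conjugation G (inv g) (conjugation G g x) = x"
  using assms by (simp_all add: conjugation_def m_assoc inv_solve_left')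
    (simp_all flip: m_assoc)

lemma conjugation_one [simp]: "g \<in> carrier G \<Longrightarrow> conjugation G g \<one> = \<one>"
  by (simp add: conjugation_def)

lemma lie_algebraD:
  assumes "D \<in> lie_algebra G"
  shows lie_closed: "\<And>f. f \<in> coord G \<Longrightarrow> D f \<in> coord G"
    and lie_outside: "\<And>f. f \<notin> coord G \<Longrightarrow> D f = undefined"
    and lie_add: "\<And>f h. f \<in> coord G \<Longrightarrow> h \<in> coord G \<Longrightarrow>
      D (\<lambda>x\<in>carrier G. f x + h x) = (\<lambda>x\<in>carrier G. D f x + D h x)"
    and lie_scale: "\<And>c f. f \<in> coord G \<Longrightarrow>
      D (\<lambda>x\<in>carrier G. c * f x) = (\<lambda>x\<in>carrier G. c * D f x)"
    and lie_mult: "\<And>f h. f \<in> coord G \<Longrightarrow> h \<in> coord G \<Longrightarrow>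
      D (\<lambda>x\<in>carrier G. f x * h x) = (\<lambda>x\<in>carrier G. D f x * h x + f x * D h x)"
    and lie_invariant: "\<And>g f. g \<in> carrier G \<Longrightarrow> f \<in> coord G \<Longrightarrow>
      D (pullback G (\<lambda>x. g \<otimes> x) f) = pullback G (\<lambda>x. g \<otimes> x) (D f)"
  using assms by (auto simp: lie_algebra_def PiE_def Pi_def extensional_def)

lemma lie_eval:
  assumes "D \<in> lie_algebra G" "f \<in> coord G" "g \<in> carrier G"
  shows "D f g = D (pullback G (\<lambda>x. g \<otimes> x) f) \<one>"
  unfolding lie_invariant[OF assms(1,3,2)] using assms(3) by (simp add: pullback_def)

lemma adjoint_action_eval:
  assumes "f \<in> coord G" "g \<in> carrier G" "x \<in> carrier G"
  shows "adjoint_action G g D f x = D (pullback G (conjugation G g) f) (conjugation G (inv g) x)"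
  using assms by (simp add: adjoint_action_def pullback_def)


text \<open>
  Conjugation by \<open>g\<close> intertwines translation by \<open>a\<close> with translation by the conjugate of \<open>a\<close>,
  which is why left invariance survives the push-forward.
\<close>
lemma adjoint_action_lie:
  assumes D: "D \<in> lie_algebra G" and g: "g \<in> carrier G"
  shows "adjoint_action G g D \<in> lie_algebra G"
proof -
  let ?c = "\<lambda>f. pullback G (conjugation G g) f"
  let ?e = "\<lambda>f. pullback G (conjugation G (inv g)) f"
  have A: "adjoint_action G g D f = ?e (D (?c f))" if "f \<in> coord G" for f
    using that by (simp add: adjoint_action_def)
  have cc: "?c f \<in> coord G" if "f \<in> coord G" for f
    using that g by (rule coord_conjugation)
  have closed: "adjoint_action G g D \<in> coord G \<rightarrow>\<^sub>E coord G"
    using D g by (auto simp: adjoint_action_def intro!: coord_conjugation lie_closed[OF D])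
  have add: "adjoint_action G g D (\<lambda>x\<in>carrier G. f x + h x)
     = (\<lambda>x\<in>carrier G. adjoint_action G g D f x + adjoint_action G g D h x)"
    if f: "f \<in> coord G" and h: "h \<in> coord G" for f h
  proof -
    have "?c (\<lambda>x\<in>carrier G. f x + h x) = (\<lambda>x\<in>carrier G. ?c f x + ?c h x)"
      using g by (auto simp: pullback_def)
    then show ?thesis
      using that g by (simp add: A coord_add lie_add[OF D cc cc]) (auto simp: pullback_def)
  qed
  have scale: "adjoint_action G g D (\<lambda>x\<in>carrier G. c * f x)
     = (\<lambda>x\<in>carrier G. c * adjoint_action G g D f x)"
    if f: "f \<in> coord G" for f c
  proof -
    have "?c (\<lambda>x\<in>carrier G. c * f x) = (\<lambda>x\<in>carrier G. c * ?c f x)"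
      using g by (auto simp: pullback_def)
    then show ?thesis
      using that g by (simp add: A coord_scale lie_scale[OF D cc]) (auto simp: pullback_def)
  qed
  have mult: "adjoint_action G g D (\<lambda>x\<in>carrier G. f x * h x)
     = (\<lambda>x\<in>carrier G. adjoint_action G g D f x * h x + f x * adjoint_action G g D h x)"
    if f: "f \<in> coord G" and h: "h \<in> coord G" for f h
  proof -
    have "?c (\<lambda>x\<in>carrier G. f x * h x) = (\<lambda>x\<in>carrier G. ?c f x * ?c h x)"
      using g by (auto simp: pullback_def)
    then show ?thesis
      using that g by (simp add: A coord_mult lie_mult[OF D cc cc]) (auto simp: pullback_def)
  qed
  have invariant: "adjoint_action G g D (pullback G (\<lambda>x. a \<otimes> x) f)
      = pullback G (\<lambda>x. a \<otimes> x) (adjoint_action G g D f)"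
    if a: "a \<in> carrier G" and f: "f \<in> coord G" for a f
  proof -
    let ?a = "conjugation G (inv g) a"
    have "?c (pullback G (\<lambda>x. a \<otimes> x) f) = pullback G (\<lambda>x. ?a \<otimes> x) (?c f)"
      using g a by (auto simp: pullback_def conjugation_mult)
    then show ?thesis
      using that g D
      by (simp add: A coord_left_translate lie_invariant[OF D] cc) (auto simp: pullback_def conjugation_mult)
  qed
  show ?thesis
    unfolding lie_algebra_def using closed add scale mult invariant by blast
qed

lemma adjoint_action_funpow:
  assumes D: "D \<in> lie_algebra G" and g: "g \<in> carrier G" and f: "f \<in> coord G"
  shows "(adjoint_action G g D ^^ n) f =
    pullback G (conjugation G (inv g)) ((D ^^ n) (pullback G (conjugation G g) f))"
proof (induction n)
  case 0
  show ?case
    using g coord_extensional[OF f] by (auto simp: pullback_def fun_eq_iff extensional_def)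
next
  case (Suc n)
  have "(D ^^ n) (pullback G (conjugation G g) f) \<in> coord G"
    by (induction n) (use D g f in \<open>auto intro: lie_closed[OF D] coord_conjugation\<close>)
  moreover from this have "pullback G (conjugation G g)
      (pullback G (conjugation G (inv g)) ((D ^^ n) (pullback G (conjugation G g) f)))
    = (D ^^ n) (pullback G (conjugation G g) f)"
    using g coord_extensional[OF calculation] by (auto simp: pullback_def fun_eq_iff extensional_def)
  ultimately show ?case
    using g Suc by (simp add: adjoint_action_def coord_conjugation)
qed

text \<open>
  The powers of the transported derivation are the transported powers.
\<close>
lemma adjoint_action_nilpotent:
  assumes D: "D \<in> nilpotent_elements G" and g: "g \<in> carrier G"
  shows "adjoint_action G g D \<in> nilpotent_elements G"
proof -
  have lie: "D \<in> lie_algebra G" using D by (simp add: nilpotent_elements_def)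
  have "\<exists>n. (adjoint_action G g D ^^ n) f = (\<lambda>x\<in>carrier G. 0)" if f: "f \<in> coord G" for f
  proof -
    obtain n where "(D ^^ n) (pullback G (conjugation G g) f) = (\<lambda>x\<in>carrier G. 0)"
      using D coord_conjugation[OF f g] by (auto simp: nilpotent_elements_def locally_nilpotent_def)
    then have "(adjoint_action G g D ^^ n) f = (\<lambda>x\<in>carrier G. 0)"
      using g by (auto simp: adjoint_action_funpow[OF lie g f] pullback_def)
    then show ?thesis ..
  qed
  then show ?thesis
    using adjoint_action_lie[OF lie g] by (simp add: nilpotent_elements_def locally_nilpotent_def)
qed

text \<open>
  Left invariance moves the value at any point back to the unit, so that the Lie algebra embeds
  into the tangent space at \<open>\<one>\<close>.
\<close>
lemma lie_algebra_eqI: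
  assumes D: "D \<in> lie_algebra G" and E: "E \<in> lie_algebra G"
    and eq: "\<And>f. f \<in> coord G \<Longrightarrow> D f \<one> = E f \<one>"
  shows "D = E"
proof
  fix f show "D f = E f"
  proof (cases "f \<in> coord G")
    case True
    have "D f x = E f x" if "x \<in> carrier G" for x
      using lie_eval[OF D True that] lie_eval[OF E True that]
        eq[OF coord_left_translate[OF True that]] by simp
    then show ?thesis
      using coord_extensional[OF lie_closed[OF D True]] coord_extensional[OF lie_closed[OF E True]]
      by (rule_tac extensionalityI) auto
  qed (simp add: lie_outside[OF D] lie_outside[OF E])
qed

lemma evaluation_lie_functional:
  assumes "f \<in> coord G"
  shows "(\<lambda>D. D f \<one>) \<in> lie_functionals G"
  using assms by (simp add: lie_functionals_def)

text \<open>
  The next three facts say that \<open>f \<mapsto> D f \<one>\<close> is a point derivation at \<open>\<one>\<close>.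
\<close>
lemma lie_const:
  assumes "D \<in> lie_algebra G"
  shows "D (\<lambda>x\<in>carrier G. c) \<one> = 0"
proof -
  let ?u = "\<lambda>x\<in>carrier G. 1 :: 'k"
  have u: "?u \<in> coord G" by (rule coord_const)
  have "(\<lambda>x\<in>carrier G. ?u x * ?u x) = ?u" by auto
  then have "D ?u \<one> = D ?u \<one> + D ?u \<one>"
    using fun_cong[OF lie_mult[OF assms u u], of \<one>] by simp
  then have "D ?u \<one> = 0" by (metis add_cancel_right_right)
  moreover have "(\<lambda>x\<in>carrier G. c * ?u x) = (\<lambda>x\<in>carrier G. c)" by auto
  ultimately show ?thesis
    using fun_cong[OF lie_scale[OF assms u], of c \<one>] by simp
qed

lemma lie_add_one:
  assumes "D \<in> lie_algebra G" "f \<in> coord G" "h \<in> coord G"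
  shows "D (\<lambda>x\<in>carrier G. f x + h x) \<one> = D f \<one> + D h \<one>"
  using lie_add[OF assms] assms by simp

lemma lie_mult_one:
  assumes "D \<in> lie_algebra G" "f \<in> coord G" "h \<in> coord G"
  shows "D (\<lambda>x\<in>carrier G. f x * h x) \<one> = D f \<one> * h \<one> + f \<one> * D h \<one>"
  using lie_mult[OF assms] assms by simp

end

section \<open>Regular functions on the general linear group\<close>

lemma function_algebra_sum:
  assumes "finite I" "\<And>i. i \<in> I \<Longrightarrow> f i \<in> function_algebra X S"
  shows "(\<lambda>x\<in>X. \<Sum>i\<in>I. f i x) \<in> function_algebra X S"
  using assms
proof (induction I rule: finite_induct)
  case empty
  show ?case unfolding sum.empty by (rule function_algebra.const)
next
  case (insert i I)
  have "(\<lambda>x\<in>X. f i x + (\<lambda>x\<in>X. \<Sum>i\<in>I. f i x) x) \<in> function_algebra X S"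
    using insert by (intro function_algebra.add) auto
  moreover have "(\<lambda>x\<in>X. f i x + (\<lambda>x\<in>X. \<Sum>i\<in>I. f i x) x) = (\<lambda>x\<in>X. \<Sum>i\<in>insert i I. f i x)"
    using insert by auto
  ultimately show ?case by (simp only:)
qed

lemma carrier_GL: "carrier (GL :: ('k::field ^ 'n ^ 'n, 'k) algebraic_group) = {A. invertible A}"
  by (simp add: GL_def)

lemma coord_GL_const:
  "(\<lambda>A\<in>{A. invertible A}. c) \<in> coord (GL :: ('k::field ^ 'n ^ 'n, 'k) algebraic_group)"
  by (simp add: GL_def function_algebra.const)

lemma coord_GL_add:
  assumes "F \<in> coord (GL :: ('k::field ^ 'n ^ 'n, 'k) algebraic_group)" "H \<in> coord GL"
  shows "(\<lambda>A\<in>{A. invertible A}. F A + H A) \<in> coord GL"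
  using assms by (simp add: GL_def function_algebra.add)

lemma coord_GL_mult:
  assumes "F \<in> coord (GL :: ('k::field ^ 'n ^ 'n, 'k) algebraic_group)" "H \<in> coord GL"
  shows "(\<lambda>A\<in>{A. invertible A}. F A * H A) \<in> coord GL"
  using assms by (simp add: GL_def function_algebra.mult)

lemma coord_GL_sum:
  assumes "finite I" "\<And>i. i \<in> I \<Longrightarrow> f i \<in> coord (GL :: ('k::field ^ 'n ^ 'n, 'k) algebraic_group)"
  shows "(\<lambda>A\<in>{A. invertible A}. \<Sum>i\<in>I. f i A) \<in> coord GL"
  using assms by (simp add: GL_def function_algebra_sum)

lemma coord_GL_entry:
  "(\<lambda>A\<in>{A. invertible A}. A $ i $ j) \<in> coord (GL :: ('k::field ^ 'n ^ 'n, 'k) algebraic_group)"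
  unfolding GL_def by (auto intro: function_algebra.gen)

lemma coord_GL_inverse_det:
  "(\<lambda>A\<in>{A. invertible A}. inverse (det A)) \<in> coord (GL :: ('k::field ^ 'n ^ 'n, 'k) algebraic_group)"
  unfolding GL_def by (auto intro: function_algebra.gen)

lemma coord_GL_induct [consumes 1, case_names const entry inverse_det add mult]:
  fixes F :: "'k::field ^ 'n ^ 'n \<Rightarrow> 'k"
  assumes "F \<in> coord GL"
    and "\<And>c. P (\<lambda>A\<in>{A. invertible A}. c)"
    and "\<And>i j. P (\<lambda>A\<in>{A. invertible A}. A $ i $ j)"
    and "P (\<lambda>A\<in>{A. invertible A}. inverse (det A))"
    and "\<And>F H. \<lbrakk>F \<in> coord GL; H \<in> coord GL; P F; P H\<rbrakk> \<Longrightarrow> P (\<lambda>A\<in>{A. invertible A}. F A + H A)"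
    and "\<And>F H. \<lbrakk>F \<in> coord GL; H \<in> coord GL; P F; P H\<rbrakk> \<Longrightarrow> P (\<lambda>A\<in>{A. invertible A}. F A * H A)"
  shows "P F"
  using assms(1) unfolding GL_def algebraic_group.simps
proof (induction rule: function_algebra.induct)
  case (gen f)
  then show ?case using assms(3,4) by (elim insertE CollectE exE conjE) (simp_all only:)
next
  case (const c)
  show ?case by (rule assms(2))
next
  case (add f h)
  show ?case by (rule assms(5)) (use add in \<open>simp_all only: GL_def algebraic_group.simps\<close>)
next
  case (mult f h)
  show ?case by (rule assms(6)) (use mult in \<open>simp_all only: GL_def algebraic_group.simps\<close>)
qed

lemma coord_GL_translate:
  fixes F :: "'k::field ^ 'n ^ 'n \<Rightarrow> 'k" and B C :: "'k ^ 'n ^ 'n"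
  assumes "F \<in> coord GL" and B: "invertible B" and C: "invertible C"
  shows "(\<lambda>A\<in>{A. invertible A}. F (B ** A ** C)) \<in> coord GL"
  using assms(1)
proof (induction rule: coord_GL_induct)
  case (const c)
  have "(\<lambda>A\<in>{A. invertible A}. (\<lambda>A\<in>{A. invertible A}. c) (B ** A ** C)) = (\<lambda>A\<in>{A. invertible A}. c)"
    using B C by (auto simp: invertible_mult)
  then show ?case by (simp only: coord_GL_const)
next
  case (entry i j)
  define t where "t = (\<lambda>l k. \<lambda>A\<in>{A :: 'k ^ 'n ^ 'n. invertible A}.
    (\<lambda>A\<in>{A :: 'k ^ 'n ^ 'n. invertible A}. B $ i $ l * C $ k $ j) A
      * (\<lambda>A\<in>{A :: 'k ^ 'n ^ 'n. invertible A}. A $ l $ k) A)"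
  have "(\<lambda>A\<in>{A. invertible A}. \<Sum>k\<in>UNIV. (\<lambda>A\<in>{A. invertible A}. \<Sum>l\<in>UNIV. t l k A) A) \<in> coord GL"
    unfolding t_def by (intro coord_GL_sum coord_GL_mult coord_GL_const coord_GL_entry) auto
  also have "(\<lambda>A\<in>{A. invertible A}. \<Sum>k\<in>UNIV. (\<lambda>A\<in>{A. invertible A}. \<Sum>l\<in>UNIV. t l k A) A)
      = (\<lambda>A\<in>{A. invertible A}. (\<lambda>A\<in>{A. invertible A}. A $ i $ j) (B ** A ** C))"
  proof -
    have "(B ** A ** C) $ i $ j = (\<Sum>k\<in>UNIV. \<Sum>l\<in>UNIV. B $ i $ l * C $ k $ j * A $ l $ k)" for A
      by (simp add: matrix_matrix_mult_def sum_distrib_right sum_distrib_left mult_ac)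
    then show ?thesis
      using B C by (auto simp: t_def invertible_mult)
  qed
  finally show ?case .
next
  case inverse_det
  let ?c = "\<lambda>c. \<lambda>A\<in>{A :: 'k ^ 'n ^ 'n. invertible A}. c :: 'k"
  let ?d = "\<lambda>A\<in>{A :: 'k ^ 'n ^ 'n. invertible A}. inverse (det A)"
  have "(\<lambda>A\<in>{A. invertible A}. ?c (inverse (det B * det C)) A * ?d A) \<in> coord GL"
    by (intro coord_GL_mult coord_GL_const coord_GL_inverse_det)
  also have "(\<lambda>A\<in>{A. invertible A}. ?c (inverse (det B * det C)) A * ?d A)
      = (\<lambda>A\<in>{A. invertible A}. ?d (B ** A ** C))"
    using B C by (auto simp: invertible_mult det_mul mult_ac intro!: restrict_ext)
  finally show ?case .
next
  case (add F H)
  have "(\<lambda>A\<in>{A. invertible A}. (\<lambda>A\<in>{A. invertible A}. F A + H A) (B ** A ** C))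
      = (\<lambda>A\<in>{A. invertible A}. (\<lambda>A\<in>{A. invertible A}. F (B ** A ** C)) A
          + (\<lambda>A\<in>{A. invertible A}. H (B ** A ** C)) A)"
    using B C by (auto simp: invertible_mult)
  then show ?case using coord_GL_add[OF add(3,4)] by (simp only:)
next
  case (mult F H)
  have "(\<lambda>A\<in>{A. invertible A}. (\<lambda>A\<in>{A. invertible A}. F A * H A) (B ** A ** C))
      = (\<lambda>A\<in>{A. invertible A}. (\<lambda>A\<in>{A. invertible A}. F (B ** A ** C)) A
          * (\<lambda>A\<in>{A. invertible A}. H (B ** A ** C)) A)"
    using B C by (auto simp: invertible_mult)
  then show ?case using coord_GL_mult[OF mult(3,4)] by (simp only:)
qed

section \<open>Classes modulo scalars and regular functions on PGL\<close>

definition pgl_class :: "'k::field ^ 'n ^ 'n \<Rightarrow> ('k ^ 'n ^ 'n) set" where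
  "pgl_class A = scalars #>\<^bsub>GL\<^esub> A"

lemma mem_pgl_class: "B \<in> pgl_class A \<longleftrightarrow> (\<exists>c. c \<noteq> 0 \<and> B = mat c ** A)"
  by (auto simp: pgl_class_def r_coset_def scalars_def GL_def)

lemma carrier_PGL:
  "carrier (PGL :: (('k::field ^ 'n ^ 'n) set, 'k) algebraic_group) = pgl_class ` {A. invertible A}"
  by (auto simp: PGL_def quotient_group_def FactGroup_def RCOSETS_def pgl_class_def carrier_GL)

lemma mult_PGL:
  fixes A B :: "'k::field ^ 'n ^ 'n"
  assumes "invertible A" "invertible B"
  shows "pgl_class A \<otimes>\<^bsub>PGL\<^esub> pgl_class B = pgl_class (A ** B)"
  using normal.rcos_sum[OF normal_scalars, of A B] assms
  by (simp add: PGL_def quotient_group_def FactGroup_def pgl_class_def carrier_GL) (simp add: GL_def)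

lemma one_PGL: "\<one>\<^bsub>PGL\<^esub> = pgl_class (mat 1 :: 'k::field ^ 'n ^ 'n)"
  by (auto simp: PGL_def quotient_group_def FactGroup_def mem_pgl_class scalars_def)

lemma coord_PGL:
  "f \<in> coord (PGL :: (('k::field ^ 'n ^ 'n) set, 'k) algebraic_group) \<longleftrightarrow>
    f \<in> extensional (carrier PGL) \<and> (\<lambda>A\<in>{A. invertible A}. f (pgl_class A)) \<in> coord GL"
  by (simp add: PGL_def quotient_group_def pgl_class_def carrier_GL)

lemma pgl_class_in_carrier [simp]: "invertible A \<Longrightarrow> pgl_class A \<in> carrier PGL"
  by (simp add: carrier_PGL)

lemma translation_closed_PGL:
  "translation_closed (PGL :: (('k::field ^ 'n ^ 'n) set, 'k) algebraic_group)"
proof -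
  interpret group "PGL :: (('k ^ 'n ^ 'n) set, 'k) algebraic_group" by (rule group_PGL)
  let ?P = "PGL :: (('k ^ 'n ^ 'n) set, 'k) algebraic_group"
  show ?thesis
  proof
    fix f a b assume f: "f \<in> coord ?P" and a: "a \<in> carrier ?P" and b: "b \<in> carrier ?P"
    obtain B C where B: "invertible B" "a = pgl_class B" and C: "invertible C" "b = pgl_class C"
      using a b by (auto simp: carrier_PGL)
    have "(\<lambda>A\<in>{A. invertible A}. (\<lambda>A\<in>{A. invertible A}. f (pgl_class A)) (B ** A ** C)) \<in> coord GL"
      by (intro coord_GL_translate B C) (use f in \<open>unfold coord_PGL, blast\<close>)
    then show "pullback PGL (\<lambda>x. a \<otimes>\<^bsub>PGL\<^esub> x \<otimes>\<^bsub>PGL\<^esub> b) f \<in> coord ?P"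
      using B C by (simp add: coord_PGL pullback_def mult_PGL invertible_mult cong: restrict_cong)
  next
    fix f h assume f: "f \<in> coord ?P" and h: "h \<in> coord ?P"
    then show "(\<lambda>x\<in>carrier PGL. f x + h x) \<in> coord ?P" "(\<lambda>x\<in>carrier PGL. f x * h x) \<in> coord ?P"
      using coord_GL_add[of "\<lambda>A\<in>{A. invertible A}. f (pgl_class A)" "\<lambda>A\<in>{A. invertible A}. h (pgl_class A)"]
        coord_GL_mult[of "\<lambda>A\<in>{A. invertible A}. f (pgl_class A)" "\<lambda>A\<in>{A. invertible A}. h (pgl_class A)"]
      by (simp_all add: coord_PGL cong: restrict_cong)
  qed (simp_all add: coord_PGL coord_GL_const cong: restrict_cong)
qed

text \<open>
  A homogeneous function of degree \<open>0\<close> on matrices is constant on classes modulo scalars.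
\<close>
lemma coord_PGL_descent:
  fixes F :: "'k::field ^ 'n ^ 'n \<Rightarrow> 'k"
  assumes F: "(\<lambda>A\<in>{A. invertible A}. F A) \<in> coord GL"
    and inv: "\<And>c A. c \<noteq> 0 \<Longrightarrow> invertible A \<Longrightarrow> F (mat c ** A) = F A"
  obtains f where "f \<in> coord PGL" "\<And>A. invertible A \<Longrightarrow> f (pgl_class A) = F A"
proof -
  define f where "f = (\<lambda>X\<in>carrier PGL. F (SOME A. A \<in> X))"
  have val: "f (pgl_class A) = F A" if "invertible A" for A
  proof -
    have "mat 1 ** A \<in> pgl_class A"
      unfolding mem_pgl_class by (intro exI[of _ 1]) auto
    then have "(SOME B. B \<in> pgl_class A) \<in> pgl_class A" by (rule someI)
    then show ?thesis
      using that by (auto simp: f_def mem_pgl_class inv)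
  qed
  moreover have "f \<in> coord PGL"
    using F by (simp add: coord_PGL f_def[symmetric] val cong: restrict_cong) (simp add: f_def)
  ultimately show ?thesis using that by blast
qed

section \<open>Affine coordinates at the unit of PGL(2)\<close>

lemma mat_mult_entry: "(mat c ** A) $ i $ j = c * (A $ i $ j :: 'k::field)"
  by (simp add: matrix_matrix_mult_def mat_def if_distrib[where f = "\<lambda>x. x * _"] cong: if_cong)

lemma pgl_class_scalar:
  fixes A :: "'k::field ^ 'n ^ 'n"
  assumes "c \<noteq> 0"
  shows "pgl_class (mat c ** A) = pgl_class A"
proof -
  have "B \<in> pgl_class (mat c ** A) \<longleftrightarrow> B \<in> pgl_class A" for B
  proof -
    have "(\<exists>d. d \<noteq> 0 \<and> B = mat (d * c) ** A) \<longleftrightarrow> (\<exists>d. d \<noteq> 0 \<and> B = mat d ** A)"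
      using assms by (metis divide_eq_0_iff mult_eq_0_iff nonzero_eq_divide_eq)
    then show ?thesis
      by (simp add: mem_pgl_class matrix_mul_assoc scalars_mult)
  qed
  then show ?thesis by blast
qed

lemma det_scalar_2: "det (mat c ** A) = c\<^sup>2 * det (A :: 'k::field ^ 2 ^ 2)"
  by (simp add: det_2 mat_mult_entry power2_eq_square algebra_simps)

lemma matrix_2_mult: "((A :: 'k::field ^ 2 ^ 2) ** B) $ i $ j = A $ i $ 1 * B $ 1 $ j + A $ i $ 2 * B $ 2 $ j"
  by (simp add: matrix_matrix_mult_def sum_2)

lemma matrix_2_eq: "(A :: 'k ^ 2 ^ 2) = B \<longleftrightarrow>
    A $ 1 $ 1 = B $ 1 $ 1 \<and> A $ 1 $ 2 = B $ 1 $ 2 \<and> A $ 2 $ 1 = B $ 2 $ 1 \<and> A $ 2 $ 2 = B $ 2 $ 2"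
  by (auto simp: vec_eq_iff forall_2)

lemma invertible_scalar_mult:
  "c \<noteq> 0 \<Longrightarrow> invertible A \<Longrightarrow> invertible (mat c ** (A :: 'k::field ^ 2 ^ 2))"
  by (simp add: invertible_det_nz det_scalar_2)

text \<open>
  The regular function \<open>a\<^sub>i\<^sub>j a\<^sub>1\<^sub>1 / det\<close> on \<open>PGL\<^sub>2\<close>. On the affine chart of matrices with
  \<open>a\<^sub>1\<^sub>1 = 1\<close>, an open neighbourhood of the unit, these are the entries divided by the
  determinant; multiplying by \<open>a\<^sub>1\<^sub>1\<close> rather than dividing by it makes them regular everywhere.
\<close>
definition affine_coord :: "2 \<Rightarrow> 2 \<Rightarrow> ('k::field ^ 2 ^ 2) set \<Rightarrow> 'k" where
  "affine_coord i j = (SOME f. f \<in> coord PGL \<and>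
     (\<forall>A. invertible A \<longrightarrow> f (pgl_class A) = A $ i $ j * A $ 1 $ 1 * inverse (det A)))"

lemma affine_coord:
  shows affine_coord_regular: "affine_coord i j \<in> coord (PGL :: (('k::field ^ 2 ^ 2) set, 'k) algebraic_group)"
    and affine_coord_class: "\<And>A :: 'k ^ 2 ^ 2. invertible A \<Longrightarrow>
      affine_coord i j (pgl_class A) = A $ i $ j * A $ 1 $ 1 * inverse (det A)"
proof -
  let ?F = "\<lambda>A :: 'k ^ 2 ^ 2. A $ i $ j * A $ 1 $ 1 * inverse (det A)"
  have "(\<lambda>A\<in>{A. invertible A}. ?F A) \<in> coord GL"
    using coord_GL_mult[OF coord_GL_mult[OF coord_GL_entry coord_GL_entry] coord_GL_inverse_det,
        where 'k = 'k, of i j 1 1]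
    by (simp cong: restrict_cong)
  moreover have "?F (mat c ** A) = ?F A" if "c \<noteq> 0" for c A
    using that by (simp add: mat_mult_entry det_scalar_2 power2_eq_square field_simps)
  ultimately obtain f where "f \<in> coord PGL" "\<And>A. invertible A \<Longrightarrow> f (pgl_class A) = ?F A"
    by (rule coord_PGL_descent) auto
  then have "\<exists>f. f \<in> coord PGL \<and> (\<forall>A. invertible A \<longrightarrow> f (pgl_class A) = ?F A)" by blast
  from someI_ex[OF this, folded affine_coord_def]
  show "affine_coord i j \<in> coord (PGL :: (('k ^ 2 ^ 2) set, 'k) algebraic_group)"
    and "\<And>A :: 'k ^ 2 ^ 2. invertible A \<Longrightarrow> affine_coord i j (pgl_class A) = ?F A"
    by auto
qed

text \<open>
  Stated for a set of extensional functions that is closed under products, since the powers of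
  \<open>affine_coord 1 1\<close> serve as denominators below.
\<close>
lemma closed_power:
  fixes S :: "('x \<Rightarrow> 'k::comm_ring_1) set"
  assumes "(\<lambda>x\<in>X. 1) \<in> S" and mult: "\<And>f h. f \<in> S \<Longrightarrow> h \<in> S \<Longrightarrow> (\<lambda>x\<in>X. f x * h x) \<in> S" and u: "u \<in> S"
  shows "(\<lambda>x\<in>X. u x ^ k) \<in> S"
proof (induction k)
  case 0
  show ?case using assms(1) by (simp only: power_0)
next
  case (Suc k)
  have "(\<lambda>x\<in>X. u x * (\<lambda>x\<in>X. u x ^ k) x) = (\<lambda>x\<in>X. u x ^ Suc k)" by auto
  then show ?case using mult[OF u Suc] by (simp only:)
qed

text \<open>
  The chart \<open>a\<^sub>1\<^sub>1 = 1\<close> is reached by the rescaling \<open>A \<mapsto> A / a\<^sub>1\<^sub>1\<close>. After rescaling, an entry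
  becomes a quotient of two affine coordinates, with denominator \<open>affine_coord 1 1\<close>, and \<open>1 / det\<close>
  becomes \<open>affine_coord 1 1\<close> itself. Hence every regular function on \<open>GL\<^sub>2\<close>, homogeneous or not,
  restricts to a polynomial in the affine coordinates divided by a power of \<open>affine_coord 1 1\<close>.
  For functions that come from \<open>PGL\<^sub>2\<close> the rescaling has no effect, so no grading of the
  coordinate ring has to be introduced to find out what those functions are.
\<close>
lemma dehomogenize:
  fixes F :: "'k::field ^ 2 ^ 2 \<Rightarrow> 'k" and S :: "(('k ^ 2 ^ 2) set \<Rightarrow> 'k) set"
  assumes F: "F \<in> coord GL"
    and const: "\<And>c. (\<lambda>x\<in>carrier PGL. c) \<in> S"
    and add: "\<And>f h. f \<in> S \<Longrightarrow> h \<in> S \<Longrightarrow> (\<lambda>x\<in>carrier PGL. f x + h x) \<in> S"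
    and mult: "\<And>f h. f \<in> S \<Longrightarrow> h \<in> S \<Longrightarrow> (\<lambda>x\<in>carrier PGL. f x * h x) \<in> S"
    and affine: "\<And>i j. affine_coord i j \<in> S"
  shows "\<exists>k. \<exists>g\<in>S. \<forall>A. invertible A \<longrightarrow> A $ 1 $ 1 \<noteq> 0 \<longrightarrow>
    F (mat (inverse (A $ 1 $ 1)) ** A) * affine_coord 1 1 (pgl_class A) ^ k = g (pgl_class A)"
  using F
proof (induction rule: coord_GL_induct)
  case (const c)
  show ?case
    by (rule exI[of _ 0], rule bexI[OF _ assms(2)[of c]]) (simp add: invertible_scalar_mult)
next
  case (entry i j)
  show ?case
    by (rule exI[of _ 1], rule bexI[OF _ affine[of i j]])
      (simp add: invertible_scalar_mult affine_coord_class mat_mult_entry)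
next
  case inverse_det
  show ?case
    by (rule exI[of _ 0], rule bexI[OF _ affine[of 1 1]])
      (simp add: invertible_scalar_mult affine_coord_class det_scalar_2 power2_eq_square)
next
  note power = closed_power[OF const[of 1] mult affine[of 1 1]]
  {
    case (add F H)
    obtain k l f h where f: "f \<in> S" "\<And>A. invertible A \<Longrightarrow> A $ 1 $ 1 \<noteq> 0 \<Longrightarrow>
        F (mat (inverse (A $ 1 $ 1)) ** A) * affine_coord 1 1 (pgl_class A) ^ k = f (pgl_class A)"
      and h: "h \<in> S" "\<And>A. invertible A \<Longrightarrow> A $ 1 $ 1 \<noteq> 0 \<Longrightarrow>
        H (mat (inverse (A $ 1 $ 1)) ** A) * affine_coord 1 1 (pgl_class A) ^ l = h (pgl_class A)"
      using add.IH by blast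
    show ?case
      by (rule exI[of _ "k + l"],
          rule bexI[OF _ assms(3)[OF assms(4)[OF f(1) power[of l]] assms(4)[OF h(1) power[of k]]]])
        (auto simp: invertible_scalar_mult f(2)[symmetric] h(2)[symmetric] power_add algebra_simps)
  next
    case (mult F H)
    obtain k l f h where f: "f \<in> S" "\<And>A. invertible A \<Longrightarrow> A $ 1 $ 1 \<noteq> 0 \<Longrightarrow>
        F (mat (inverse (A $ 1 $ 1)) ** A) * affine_coord 1 1 (pgl_class A) ^ k = f (pgl_class A)"
      and h: "h \<in> S" "\<And>A. invertible A \<Longrightarrow> A $ 1 $ 1 \<noteq> 0 \<Longrightarrow>
        H (mat (inverse (A $ 1 $ 1)) ** A) * affine_coord 1 1 (pgl_class A) ^ l = h (pgl_class A)"
      using mult.IH by blast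
    show ?case
      by (rule exI[of _ "k + l"], rule bexI[OF _ assms(4)[OF f(1) h(1)]])
        (auto simp: invertible_scalar_mult f(2)[symmetric] h(2)[symmetric] power_add algebra_simps)
  }
qed

text \<open>
  The functions on which two point derivations at \<open>\<one>\<close> agree form a ring. If it contains the affine
  coordinates, then by dehomogenization it contains \<open>f * u ^ k\<close> for every regular \<open>f\<close> and some
  \<open>k\<close>, where \<open>u = affine_coord 1 1\<close>; since \<open>u\<close> is \<open>1\<close> at the unit, the Leibniz rule can be
  solved for the value on \<open>f\<close>.
\<close>
lemma lie_algebra_PGL_eqI:
  fixes D E :: "(('k::field ^ 2 ^ 2) set \<Rightarrow> 'k) \<Rightarrow> (('k ^ 2 ^ 2) set \<Rightarrow> 'k)"
  assumes D: "D \<in> lie_algebra PGL" and E: "E \<in> lie_algebra PGL"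
    and eq: "\<And>i j. D (affine_coord i j) \<one>\<^bsub>PGL\<^esub> = E (affine_coord i j) \<one>\<^bsub>PGL\<^esub>"
  shows "D = E"
proof -
  let ?P = "PGL :: (('k ^ 2 ^ 2) set, 'k) algebraic_group"
  interpret translation_closed ?P by (rule translation_closed_PGL)
  let ?S = "{g \<in> coord ?P. D g \<one>\<^bsub>?P\<^esub> = E g \<one>\<^bsub>?P\<^esub>}"
  let ?u = "affine_coord 1 1 :: ('k ^ 2 ^ 2) set \<Rightarrow> 'k"
  have const: "(\<lambda>x\<in>carrier ?P. c) \<in> ?S" for c
    using coord_const lie_const[OF D] lie_const[OF E] by simp
  have add: "(\<lambda>x\<in>carrier ?P. f x + h x) \<in> ?S" if "f \<in> ?S" "h \<in> ?S" for f h
    using that coord_add[of f h] lie_add_one[OF D, of f h] lie_add_one[OF E, of f h] by simp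
  have mult: "(\<lambda>x\<in>carrier ?P. f x * h x) \<in> ?S" if "f \<in> ?S" "h \<in> ?S" for f h
    using that coord_mult[of f h] lie_mult_one[OF D, of f h] lie_mult_one[OF E, of f h] by simp
  have affine: "affine_coord i j \<in> ?S" for i j
    using eq affine_coord_regular by auto
  note power = closed_power[OF const[of 1] mult affine[of 1 1]]
  have u1: "?u \<one>\<^bsub>?P\<^esub> = 1"
    unfolding one_PGL by (subst affine_coord_class) (simp_all add: invertible_det_nz, simp add: mat_def)
  show ?thesis
  proof (rule lie_algebra_eqI[OF D E])
    fix f assume f: "f \<in> coord ?P"
    have "(\<lambda>A\<in>{A. invertible A}. f (pgl_class A)) \<in> coord GL"
      using f by (simp only: coord_PGL)
    from dehomogenize[OF this const add mult affine]
    obtain k g where g: "g \<in> ?S" "\<And>A. invertible A \<Longrightarrow> A $ 1 $ 1 \<noteq> 0 \<Longrightarrow>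
      (\<lambda>A\<in>{A. invertible A}. f (pgl_class A)) (mat (inverse (A $ 1 $ 1)) ** A) * ?u (pgl_class A) ^ k
        = g (pgl_class A)"
      by blast
    \<comment> \<open>The identity on the chart extends to the whole group after one more multiplication by \<open>u\<close>,
      which vanishes off the chart.\<close>
    let ?U = "\<lambda>x\<in>carrier ?P. ?u x ^ Suc k"
    have "f (pgl_class A) * ?u (pgl_class A) ^ Suc k = g (pgl_class A) * ?u (pgl_class A)"
      if A: "invertible A" for A
    proof (cases "A $ 1 $ 1 = 0")
      case True
      then show ?thesis using A by (simp add: affine_coord_class)
    next
      case False
      then show ?thesis
        using A g(2)[OF A False] by (simp add: invertible_scalar_mult pgl_class_scalar)
    qed
    then have "(\<lambda>x\<in>carrier ?P. f x * ?U x) = (\<lambda>x\<in>carrier ?P. g x * ?u x)"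
      by (intro restrict_ext) (auto simp: carrier_PGL)
    then have "(\<lambda>x\<in>carrier ?P. f x * ?U x) \<in> ?S"
      using mult[OF g(1) affine[of 1 1]] by (simp only:)
    moreover have U: "?U \<in> ?S" by (rule power)
    ultimately show "D f \<one>\<^bsub>?P\<^esub> = E f \<one>\<^bsub>?P\<^esub>"
      using f lie_mult_one[OF D f, of ?U] lie_mult_one[OF E f, of ?U] u1 by simp
  qed
qed

section \<open>Two facts on fields and polynomials\<close>

lemma infinite_alg_closed: "infinite (UNIV :: 'k::alg_closed_field set)"
proof
  assume fin: "finite (UNIV :: 'k set)"
  define p where "p = (\<Prod>a\<in>(UNIV :: 'k set). [:- a, 1:])"
  have "degree p = card (UNIV :: 'k set)"
    unfolding p_def by (subst degree_prod_eq_sum_degree) auto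
  then have "degree p > 0" using fin by (simp add: card_gt_0_iff)
  then have "degree (p + 1) > 0" by (simp add: degree_add_eq_left)
  then obtain x where "poly (p + 1) x = 0" using alg_closed_imp_poly_has_root by blast
  moreover have "poly p x = 0" using fin by (auto simp: p_def poly_prod prod_zero_iff)
  ultimately show False by simp
qed

text \<open>
  A Laurent polynomial in \<open>t\<^sup>2\<close> has no monomial of odd degree. In characteristic \<open>2\<close> this is seen by
  differentiation, which kills all polynomials in \<open>t\<^sup>2\<close> but not \<open>t ^ (2 * m + 1)\<close>.
\<close>
lemma odd_laurent_constant_zero:
  fixes g :: "'k::field \<Rightarrow> 'k"
  assumes inf: "infinite (UNIV :: 'k set)" and char: "CHAR('k) = 2"
    and laurent: "\<And>s. s \<noteq> 0 \<Longrightarrow> g s * s ^ m = poly P s"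
    and odd: "\<And>t. t \<noteq> 0 \<Longrightarrow> g (t\<^sup>2) = t * c"
  shows "c = 0"
proof -
  let ?M = "monom c (2 * m + 1)" and ?Q = "pcompose P (monom 1 2)"
  have two: "(2 :: 'k) = 0" using of_nat_CHAR[where 'a = 'k] char by simp
  have "poly (?M - ?Q) t = 0" if "t \<noteq> 0" for t
    using laurent[of "t\<^sup>2"] odd[OF that] that
    by (simp add: poly_monom poly_pcompose mult_ac flip: power_mult)
  then have "UNIV - {0} \<subseteq> {t. poly (?M - ?Q) t = 0}" by auto
  moreover have "infinite (UNIV - {0 :: 'k})" using inf by simp
  ultimately have "?M - ?Q = 0" using poly_roots_finite finite_subset by blast
  then have "pderiv ?M = pderiv ?Q" by simp
  also have "pderiv ?Q = 0" by (simp add: pderiv_pcompose pderiv_monom two)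
  finally show ?thesis by (simp add: pderiv_monom two)
qed

section \<open>The torus and the involution\<close>

definition dilation :: "'k::field \<Rightarrow> 'k ^ 2 ^ 2" where
  "dilation t = (\<chi> i j. if i = j then (if i = 1 then t else 1) else 0)"

definition antidiagonal :: "'k::field \<Rightarrow> 'k ^ 2 ^ 2" where
  "antidiagonal s = (\<chi> i j. if i = j then 0 else if i = 1 then s else 1)"

lemma invertible_dilation: "invertible (dilation t) \<longleftrightarrow> t \<noteq> 0"
  by (simp add: invertible_det_nz det_2 dilation_def)

lemma invertible_antidiagonal: "invertible (antidiagonal t) \<longleftrightarrow> t \<noteq> 0"
  by (simp add: invertible_det_nz det_2 antidiagonal_def)

lemma det_dilation: "det (dilation t) = t"
  by (simp add: det_2 dilation_def)

lemma dilation_mult_entry: "(dilation t ** A ** dilation u) $ i $ j =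
    (if i = 1 then t else 1) * A $ i $ j * (if j = 1 then u else 1)"
proof -
  have "i = 1 \<or> i = 2" "j = 1 \<or> j = 2" using exhaust_2 by auto
  then show ?thesis by (auto simp: matrix_2_mult dilation_def)
qed

lemma inv_dilation:
  assumes "t \<noteq> (0 :: 'k::field)"
  shows "inv\<^bsub>PGL\<^esub> (pgl_class (dilation t)) = pgl_class (dilation (inverse t))"
proof -
  interpret group "PGL :: (('k ^ 2 ^ 2) set, 'k) algebraic_group" by (rule group_PGL)
  have "dilation (inverse t) ** dilation t = mat 1"
    using assms by (simp add: matrix_2_eq matrix_2_mult dilation_def mat_def)
  then show ?thesis
    using assms by (intro inv_equality) (auto simp: mult_PGL invertible_dilation one_PGL)
qed

lemma conjugation_dilation:
  assumes "t \<noteq> (0 :: 'k::field)" "invertible A"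
  shows "conjugation PGL (pgl_class (dilation t)) (pgl_class A)
    = pgl_class (dilation t ** A ** dilation (inverse t))"
  using assms by (simp add: conjugation_def inv_dilation mult_PGL invertible_dilation invertible_mult)

text \<open>
  The conjugate of the involution by \<open>dilation t\<close> is the antidiagonal matrix with entries \<open>t\<close> and
  \<open>1 / t\<close>. Up to a scalar it depends on \<open>t\<^sup>2\<close> only, although \<open>t\<close> itself acts: this is the
  parity on which the proof rests.
\<close>
lemma conjugation_antidiagonal:
  assumes "t \<noteq> (0 :: 'k::field)"
  shows "conjugation PGL (pgl_class (dilation t)) (pgl_class (antidiagonal 1))
    = pgl_class (antidiagonal (t\<^sup>2))"
proof -
  have "antidiagonal (t\<^sup>2) = mat t ** (dilation t ** antidiagonal 1 ** dilation (inverse t))"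
    unfolding matrix_2_eq mat_mult_entry
    using assms by (simp add: matrix_2_mult dilation_def antidiagonal_def power2_eq_square)
  then show ?thesis
    using assms by (simp add: conjugation_dilation invertible_antidiagonal pgl_class_scalar)
qed

text \<open>
  The root of the diagonal torus that belongs to the position \<open>(i, j)\<close>.
\<close>
definition weight :: "2 \<Rightarrow> 2 \<Rightarrow> 'k::field \<Rightarrow> 'k" where
  "weight i j t = (if i = j then 1 else if i = 1 then t else inverse t)"

lemma affine_coord_weight:
  assumes t: "t \<noteq> (0 :: 'k::field)"
  shows "pullback PGL (conjugation PGL (pgl_class (dilation t))) (affine_coord i j)
    = (\<lambda>x\<in>carrier PGL. weight i j t * affine_coord i j x)"
proof -
  have "affine_coord i j (pgl_class (dilation t ** A ** dilation (inverse t)))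
      = weight i j t * affine_coord i j (pgl_class A)" if A: "invertible A" for A
  proof -
    have "i = 1 \<or> i = 2" "j = 1 \<or> j = 2" using exhaust_2 by auto
    moreover have "invertible (dilation t ** A ** dilation (inverse t))"
      using t A by (simp add: invertible_mult invertible_dilation)
    ultimately show ?thesis
      using t A by (auto simp: affine_coord_class dilation_mult_entry det_mul det_dilation weight_def)
  qed
  then show ?thesis
    using t unfolding pullback_def by (intro restrict_ext) (auto simp: carrier_PGL conjugation_dilation)
qed

lemma adjoint_action_weight:
  fixes D :: "(('k::field ^ 2 ^ 2) set \<Rightarrow> 'k) \<Rightarrow> (('k ^ 2 ^ 2) set \<Rightarrow> 'k)"
  assumes D: "D \<in> lie_algebra PGL" and t: "t \<noteq> 0"
  shows "adjoint_action PGL (pgl_class (dilation t)) D (affine_coord i j) \<one>\<^bsub>PGL\<^esub>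
    = weight i j t * D (affine_coord i j) \<one>\<^bsub>PGL\<^esub>"
proof -
  interpret translation_closed "PGL :: (('k ^ 2 ^ 2) set, 'k) algebraic_group"
    by (rule translation_closed_PGL)
  show ?thesis
    using t by (simp add: adjoint_action_eval affine_coord_regular invertible_dilation
      affine_coord_weight lie_scale[OF D affine_coord_regular])
qed

text \<open>
  Only the trivial weight is left among the affine coordinates of \<open>D\<close>.
\<close>
lemma adjoint_action_dilation_fixed:
  fixes D :: "(('k::field ^ 2 ^ 2) set \<Rightarrow> 'k) \<Rightarrow> (('k ^ 2 ^ 2) set \<Rightarrow> 'k)"
  assumes D: "D \<in> lie_algebra PGL" and t: "t \<noteq> 0"
    and off: "\<And>i j. i \<noteq> j \<Longrightarrow> D (affine_coord i j) \<one>\<^bsub>PGL\<^esub> = 0"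
  shows "adjoint_action PGL (pgl_class (dilation t)) D = D"
proof -
  interpret translation_closed "PGL :: (('k ^ 2 ^ 2) set, 'k) algebraic_group"
    by (rule translation_closed_PGL)
  have "pgl_class (dilation t) \<in> carrier PGL" using t by (simp add: invertible_dilation)
  then show ?thesis
    using D t off
    by (intro lie_algebra_PGL_eqI adjoint_action_lie) (auto simp: adjoint_action_weight weight_def)
qed

text \<open>
  The determinant of \<open>antidiagonal s\<close> is \<open>- s\<close>, so that negative powers of \<open>s\<close> can occur.
\<close>
lemma antidiagonal_laurent:
  fixes F :: "'k::field ^ 2 ^ 2 \<Rightarrow> 'k"
  assumes "F \<in> coord GL"
  shows "\<exists>m P. \<forall>s. s \<noteq> 0 \<longrightarrow> F (antidiagonal s) * s ^ m = poly P s"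
  using assms
proof (induction rule: coord_GL_induct)
  case (const c)
  show ?case by (rule exI[of _ 0], rule exI[of _ "[:c:]"]) (simp add: invertible_antidiagonal)
next
  case (entry i j)
  show ?case
    by (rule exI[of _ 0], rule exI[of _ "if i = j then 0 else if i = 1 then [:0, 1:] else 1"])
      (simp add: invertible_antidiagonal, simp add: antidiagonal_def)
next
  case inverse_det
  show ?case
    by (rule exI[of _ 1], rule exI[of _ "[:-1:]"])
      (simp add: invertible_antidiagonal, simp add: antidiagonal_def det_2)
next
  case (add F H)
  then obtain m P n Q where
    P: "\<And>s. s \<noteq> 0 \<Longrightarrow> F (antidiagonal s) * s ^ m = poly P s" and
    Q: "\<And>s. s \<noteq> 0 \<Longrightarrow> H (antidiagonal s) * s ^ n = poly Q s" by blast
  have "(F (antidiagonal s) + H (antidiagonal s)) * s ^ (m + n) = poly (P * monom 1 n + Q * monom 1 m) s"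
    if "s \<noteq> 0" for s
    by (simp add: poly_monom P[OF that, symmetric] Q[OF that, symmetric] power_add algebra_simps)
  then show ?case
    by (intro exI[of _ "m + n"] exI[of _ "P * monom 1 n + Q * monom 1 m"]) (simp add: invertible_antidiagonal)
next
  case (mult F H)
  then obtain m P n Q where
    P: "\<And>s. s \<noteq> 0 \<Longrightarrow> F (antidiagonal s) * s ^ m = poly P s" and
    Q: "\<And>s. s \<noteq> 0 \<Longrightarrow> H (antidiagonal s) * s ^ n = poly Q s" by blast
  have "(F (antidiagonal s) * H (antidiagonal s)) * s ^ (m + n) = poly (P * Q) s"
    if "s \<noteq> 0" for s
    by (simp add: poly_monom P[OF that, symmetric] Q[OF that, symmetric] power_add algebra_simps)
  then show ?case
    by (intro exI[of _ "m + n"] exI[of _ "P * Q"]) (simp add: invertible_antidiagonal)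
qed

text \<open>
  Translation by an involution satisfies \<open>R\<^sup>2 = 1\<close>, whence \<open>(R - 1)\<^sup>2 = 2 (1 - R)\<close>, which is zero in
  characteristic \<open>2\<close>. In every other characteristic this element is semisimple.
\<close>
lemma antidiagonal_unipotent:
  assumes char: "CHAR('k::field) = 2"
  shows "pgl_class (antidiagonal 1 :: 'k ^ 2 ^ 2) \<in> unipotent_elements PGL"
proof -
  interpret translation_closed "PGL :: (('k ^ 2 ^ 2) set, 'k) algebraic_group"
    by (rule translation_closed_PGL)
  let ?P = "PGL :: (('k ^ 2 ^ 2) set, 'k) algebraic_group"
  let ?w = "pgl_class (antidiagonal 1 :: 'k ^ 2 ^ 2)"
  let ?T = "\<lambda>f :: ('k ^ 2 ^ 2) set \<Rightarrow> 'k. \<lambda>x\<in>carrier ?P. f (x \<otimes>\<^bsub>?P\<^esub> ?w) - f x"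
  have two: "(2 :: 'k) = 0" using of_nat_CHAR[where 'a = 'k] char by simp
  have w: "?w \<in> carrier ?P" by (simp add: invertible_antidiagonal)
  have "antidiagonal 1 ** antidiagonal 1 = (mat 1 :: 'k ^ 2 ^ 2)"
    by (simp add: matrix_2_eq matrix_2_mult antidiagonal_def mat_def)
  then have ww: "?w \<otimes>\<^bsub>?P\<^esub> ?w = \<one>\<^bsub>?P\<^esub>"
    by (simp add: mult_PGL invertible_antidiagonal one_PGL)
  have "(?T ^^ 2) f = (\<lambda>x\<in>carrier ?P. 0)" for f :: "('k ^ 2 ^ 2) set \<Rightarrow> 'k"
  proof -
    have "(?T ^^ 2) f = (\<lambda>x\<in>carrier ?P. 2 * (f x - f (x \<otimes>\<^bsub>?P\<^esub> ?w)))"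
      using w ww by (auto simp: numeral_2_eq_2 m_assoc intro!: restrict_ext)
    then show ?thesis by (simp add: two)
  qed
  then show ?thesis
    using w by (auto simp: unipotent_elements_def locally_nilpotent_def)
qed

section \<open>Nonexistence of a Springer isomorphism\<close>

theorem corollary7p0p3:
  assumes "CHAR('k::alg_closed_field) = 2"
  shows "\<not> (\<exists>\<phi>. springer_isomorphism (PGL :: (('k ^ 2 ^ 2) set, 'k) algebraic_group) \<phi>)"
proof
  let ?P = "PGL :: (('k ^ 2 ^ 2) set, 'k) algebraic_group"
  let ?N = "nilpotent_elements ?P" and ?U = "unipotent_elements ?P"
  let ?h = "\<lambda>t. pgl_class (dilation t :: 'k ^ 2 ^ 2)"
  let ?w = "\<lambda>s. pgl_class (antidiagonal s :: 'k ^ 2 ^ 2)"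
  interpret translation_closed ?P by (rule translation_closed_PGL)
  assume "\<exists>\<phi>. springer_isomorphism ?P \<phi>"
  then obtain \<phi> where \<phi>: "springer_isomorphism ?P \<phi>" ..
  define \<psi> where "\<psi> = inv_into ?N \<phi>"
  have points: "points (nilpotent_variety ?P) = ?N" "points (unipotent_variety ?P) = ?U"
    by (simp_all add: nilpotent_variety_def unipotent_variety_def subvariety_def)
  have bij: "bij_betw \<phi> ?N ?U"
    and \<psi>: "variety_morphism (unipotent_variety ?P) (nilpotent_variety ?P) \<psi>"
    using \<phi> by (simp_all add: springer_isomorphism_def variety_isomorphism_def points \<psi>_def)
  have equivariant: "\<phi> (adjoint_action ?P g D) = conjugation ?P g (\<phi> D)"
    if "g \<in> carrier ?P" "D \<in> ?N" for g D
    using \<phi> that by (simp add: springer_isomorphism_def)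
  define D where "D = \<psi> (?w 1)"
  have w: "?w 1 \<in> ?U" using assms by (rule antidiagonal_unipotent)
  have D: "D \<in> ?N" and \<phi>D: "\<phi> D = ?w 1"
    using bij_betw_inv_into[OF bij] bij_betw_inv_into_right[OF bij w] w
    by (auto simp: D_def \<psi>_def bij_betw_def)
  have lie: "D \<in> lie_algebra ?P" using D by (simp add: nilpotent_elements_def)
  have h: "?h t \<in> carrier ?P" if "t \<noteq> 0" for t using that by (simp add: invertible_dilation)
  have orbit: "\<phi> (adjoint_action ?P (?h t) D) = ?w (t\<^sup>2)" if "t \<noteq> 0" for t
    using equivariant[OF h D] that by (simp add: \<phi>D conjugation_antidiagonal)
  have inf: "infinite (UNIV :: 'k set)" by (rule infinite_alg_closed)
  have "D (affine_coord i j) \<one>\<^bsub>?P\<^esub> = 0" if ij: "i \<noteq> j" for i j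
  proof -
    define c where "c = D (affine_coord i j) \<one>\<^bsub>?P\<^esub>"
    let ?l = "\<lambda>E. E (affine_coord i j) \<one>\<^bsub>?P\<^esub>"
    have "?l \<in> lie_functionals ?P"
      by (rule evaluation_lie_functional) (rule affine_coord_regular)
    then have "restrict ?l (lie_algebra ?P) \<in> regular (lie_variety ?P)"
      unfolding lie_variety_def variety.simps by (rule function_algebra.gen)
    then have "restrict (restrict ?l (lie_algebra ?P)) ?N \<in> regular (nilpotent_variety ?P)"
      unfolding nilpotent_variety_def subvariety_def variety.simps by (rule imageI)
    then have "(\<lambda>x\<in>?U. restrict (restrict ?l (lie_algebra ?P)) ?N (\<psi> x)) \<in> regular (unipotent_variety ?P)"
      by (rule bspec[OF conjunct2[OF \<psi>[unfolded variety_morphism_def points]]])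
    then obtain f where f: "f \<in> coord ?P"
      and eq: "(\<lambda>x\<in>?U. restrict (restrict ?l (lie_algebra ?P)) ?N (\<psi> x)) = restrict f ?U"
      by (auto simp: unipotent_variety_def subvariety_def group_variety_def)
    \<comment> \<open>\<open>g\<close> describes the functional \<open>?l\<close> along the curve of antidiagonal classes in the unipotent
      variety; the adjoint action on \<open>D\<close> shows that it has odd weight.\<close>
    define g where "g s = f (?w s)" for s
    have g: "g (t\<^sup>2) = weight i j t * c" if t: "t \<noteq> 0" for t
    proof -
      let ?E = "adjoint_action ?P (?h t) D"
      have E: "?E \<in> ?N" using adjoint_action_nilpotent[OF D h[OF t]] .
      then have "?w (t\<^sup>2) \<in> ?U" "\<psi> (?w (t\<^sup>2)) = ?E"
        using bij orbit[OF t] bij_betw_inv_into_left[OF bij E] by (auto simp: bij_betw_def \<psi>_def)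
      then have "g (t\<^sup>2) = ?l ?E"
        using fun_cong[OF eq, of "?w (t\<^sup>2)"] E by (simp add: g_def nilpotent_elements_def)
      then show ?thesis using adjoint_action_weight[OF lie t] by (simp add: c_def)
    qed
    have "(\<lambda>A\<in>{A. invertible A}. f (pgl_class A)) \<in> coord GL" using f by (simp only: coord_PGL)
    from antidiagonal_laurent[OF this] obtain m P where
      P: "\<And>s. s \<noteq> 0 \<Longrightarrow> g s * s ^ m = poly P s"
      by (auto simp: invertible_antidiagonal g_def)
    have "c = 0"
    proof (cases "i = 1")
      case True
      show ?thesis
        by (rule odd_laurent_constant_zero[OF inf assms P]) (use g True ij in \<open>auto simp: weight_def\<close>)
    next
      case False
      show ?thesis
      proof (rule odd_laurent_constant_zero[OF inf assms, where g = "\<lambda>s. s * g s" and P = "pCons 0 P"])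
        \<comment> \<open>The weight is now \<open>inverse t\<close>; the extra factor \<open>s = t\<^sup>2\<close> turns it into \<open>t\<close>.\<close>
        show "s * g s * s ^ m = poly (pCons 0 P) s" if "s \<noteq> 0" for s
          using P[OF that] by (simp add: mult.assoc)
        show "t\<^sup>2 * g (t\<^sup>2) = t * c" if "t \<noteq> 0" for t
          using g[OF that] that False ij by (simp add: weight_def power2_eq_square)
      qed
    qed
    then show ?thesis by (simp add: c_def)
  qed
  then have fixed: "adjoint_action ?P (?h t) D = D" if "t \<noteq> 0" for t
    using adjoint_action_dilation_fixed[OF lie that] by blast
  \<comment> \<open>A torus element with \<open>t\<^sup>2 \<noteq> 1\<close> fixes \<open>D\<close> and hence the involution, which it moves in fact.\<close>
  obtain t :: 'k where t: "t \<noteq> 0" "t \<noteq> 1" "t \<noteq> -1"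
    using ex_new_if_finite[OF inf, of "{0, 1, -1}"] by auto
  have "antidiagonal (t\<^sup>2) \<in> ?w 1"
  proof -
    have "?w 1 = ?w (t\<^sup>2)" using orbit[OF t(1)] fixed[OF t(1)] \<phi>D by simp
    moreover have "antidiagonal (t\<^sup>2) \<in> ?w (t\<^sup>2)"
      unfolding mem_pgl_class by (intro exI[of _ 1]) simp
    ultimately show ?thesis by simp
  qed
  then obtain c where "antidiagonal (t\<^sup>2) = mat c ** antidiagonal 1" by (auto simp: mem_pgl_class)
  then have "t\<^sup>2 = 1"
    by (auto simp: matrix_2_eq mat_mult_entry antidiagonal_def)
  with t show False by (simp add: power2_eq_1_iff)
qed

end
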